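(* Let $\lambda$ be a nonzero real number. For every integer $n\ge 0$, $$(x)_{n,\lambda}=\sum_{k=0}^{n}S_{1,\lambda}(n,k)\,\phi_{k,\lambda}(x).$$
   Context: For $\lambda\neq 0$: $(x)_{0,\lambda}=1$ and $(x)_{n,\lambda}=x(x-\lambda)\cdots(x-(n-1)\lambda)$ for $n\ge1$. The degenerate exponential is $e_\lambda^{x}(t)=\sum_{k\ge0}(x)_{k,\lambda}\frac{t^k}{k!}=(1+\lambda t)^{x/\lambda}$, $e_\lambda(t)=e_\lambda^1(t)$, and $\log_\lambda(1+t)=\frac{1}{\lambda}\big((1+t)^\lambda-1\big)$ is the compositional inverse of $e_\lambda(t)$. The degenerate Stirling numbers of the first kind are defined by $\frac{1}{k!}(\log_\lambda(1+t))^k=\sum_{n\ge k}S_{1,\lambda}(n,k)\frac{t^n}{n!}$. The fully degenerate Bell polynomials $\phi_{n,\lambda}(x)$ are defined by $e_\lambda^{x}\big(e_\lambda(t)-1\big)=\sum_{n\ge0}\phi_{n,\lambda}(x)\frac{t^n}{n!}$. *)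

theory Defs
  imports Complex_Main "HOL-Computational_Algebra.Formal_Power_Series"
begin

definition degen_falling :: "real \<Rightarrow> real \<Rightarrow> nat \<Rightarrow> real" where
  "degen_falling lam x n = (\<Prod>i<n. x - real i * lam)"

(* The series e_lam^x(t), as a formal power series in t. *)
definition degen_exp :: "real \<Rightarrow> real \<Rightarrow> real fps" where
  "degen_exp lam x = Abs_fps (\<lambda>k. degen_falling lam x k / fact k)"

(* The series log_lam(1 + t) in t; fps_binomial lam is the binomial series (1 + t)^lam. *)
definition degen_log :: "real \<Rightarrow> real fps" where
  "degen_log lam = fps_const (1 / lam) * (fps_binomial lam - 1)"

definition degen_stirling1 :: "real \<Rightarrow> nat \<Rightarrow> nat \<Rightarrow> real" where
  "degen_stirling1 lam n k = fact n * fps_nth (fps_const (1 / fact k) * degen_log lam ^ k) n"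

(* The inner series e_lam(t) - 1 has constant term 0, so that fps_compose is
   genuine substitution. *)
definition degen_bell :: "real \<Rightarrow> nat \<Rightarrow> real \<Rightarrow> real" where
  "degen_bell lam n x = fact n * fps_nth (fps_compose (degen_exp lam x) (degen_exp lam 1 - 1)) n"

lemma degen_exp_eq_binomial:
  assumes "lam \<noteq> 0"
  shows "degen_exp lam x = fps_compose (fps_binomial (x / lam)) (fps_const lam * fps_X)"
proof (rule fps_ext)
  fix n
  have "degen_falling lam x n = (\<Prod>i<n. lam * (x / lam - real i))"
    unfolding degen_falling_def using assms by (intro prod.cong) (auto simp: field_simps)
  also have "\<dots> = lam ^ n * (\<Prod>i<n. x / lam - real i)"
    by (simp add: prod.distrib)
  finally show "fps_nth (degen_exp lam x) n =
      fps_nth (fps_compose (fps_binomial (x / lam)) (fps_const lam * fps_X)) n"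
    by (simp add: degen_exp_def fps_compose_linear gbinomial_prod_rev atLeast0LessThan)
qed

lemma degen_exp_minus_one_nth_0: "fps_nth (degen_exp lam 1 - 1) 0 = 0"
  by (simp add: degen_exp_def degen_falling_def)

lemma degen_stirling1_gf:
  "fps_const (1 / fact k) * degen_log lam ^ k = Abs_fps (\<lambda>n. degen_stirling1 lam n k / fact n)"
  by (rule fps_ext) (simp add: degen_stirling1_def)

lemma degen_stirling1_eq_0: "n < k \<Longrightarrow> degen_stirling1 lam n k = 0"
  using startsby_zero_power_prefix[of "degen_log lam" k]
  by (simp add: degen_stirling1_def degen_log_def)

lemma degen_bell_gf:
  "fps_compose (degen_exp lam x) (degen_exp lam 1 - 1) = Abs_fps (\<lambda>n. degen_bell lam n x / fact n)"
  by (rule fps_ext) (simp add: degen_bell_def)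

end

(* With L = log_lam(1 + t), the identity (e_lam - 1) o L = t turns the generating
   function e_lam^x(e_lam(t) - 1) of the degenerate Bell polynomials into e_lam^x(t) upon
   substituting L for t. Since L^k / k! generates S_{1,lam}(n, k), comparing coefficients
   of t^n gives the theorem. *)

theory Submission
  imports Defs
begin

text \<open>This is the power law \<open>((1 + t)^b)^a = (1 + t)^(a * b)\<close> for formal series:
  both sides solve \<open>(1 + t) * F' = a * b * F\<close> with constant term 1, and this determines
  \<open>F\<close>.\<close>

lemma fps_binomial_compose_binomial:
  fixes a b :: "'a :: field_char_0"
  shows "fps_binomial a oo (fps_binomial b - 1) = fps_binomial (a * b)"
proof -
  let ?g = "fps_binomial b - 1 :: 'a fps"
  let ?F = "fps_binomial a oo ?g"
  have g0: "fps_nth ?g 0 = 0" by simp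
  have B0: "fps_nth (fps_binomial b) 0 \<noteq> (0 :: 'a)" by simp
  have "fps_deriv ?F = (fps_deriv (fps_binomial a) oo ?g) * fps_deriv ?g"
    by (rule fps_compose_deriv[OF g0])
  \<comment> \<open>Substituting \<open>?g\<close> turns the denominator \<open>1 + fps_X\<close>
    into \<open>fps_binomial b\<close>, which later cancels against the same factor in
    \<open>fps_deriv ?g\<close>.\<close>
  also have "fps_deriv (fps_binomial a) oo ?g = fps_const a * ?F * inverse (fps_binomial b)"
    by (simp add: fps_binomial_deriv fps_divide_unit fps_inverse_compose
        fps_compose_mult_distrib fps_compose_add_distrib)
  also have "fps_deriv ?g = fps_const b * fps_binomial b * inverse (1 + fps_X)"
    by (simp add: fps_binomial_deriv fps_divide_unit)
  also have "fps_const a * ?F * inverse (fps_binomial b)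
        * (fps_const b * fps_binomial b * inverse (1 + fps_X))
      = (inverse (fps_binomial b) * fps_binomial b)
        * (fps_const a * fps_const b * ?F * inverse (1 + fps_X))"
    by (simp only: ac_simps)
  also have "\<dots> = fps_const (a * b) * ?F / (1 + fps_X)"
    by (simp add: inverse_mult_eq_1[OF B0] fps_divide_unit)
  finally have "fps_deriv ?F = fps_const (a * b) * ?F / (1 + fps_X)" .
  then show ?thesis
    using fps_binomial_ODE_unique'[of ?F "a * b"] by simp
qed

lemma degen_log_nth_0: "fps_nth (degen_log lam) 0 = 0"
  by (simp add: degen_log_def)

text \<open>Since \<open>e_lam(t) = (1 + lam * t)^(1 / lam)\<close> and
  \<open>1 + lam * L = (1 + t)^lam\<close> for \<open>L = degen_log lam\<close>, the power law
  leaves the exponent \<open>(1 / lam) * lam = 1\<close>.\<close>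

lemma degen_exp_compose_degen_log:
  assumes "lam \<noteq> 0"
  shows "degen_exp lam 1 oo degen_log lam = 1 + fps_X"
proof -
  have "fps_const lam * fps_X oo degen_log lam = fps_const lam * degen_log lam"
    by (simp add: fps_compose_mult_distrib degen_log_nth_0)
  also have "\<dots> = (fps_const lam * fps_const (1 / lam)) * (fps_binomial lam - 1)"
    by (simp only: degen_log_def mult.assoc)
  also have "\<dots> = fps_binomial lam - 1"
    using assms by simp
  finally have "degen_exp lam 1 oo degen_log lam = fps_binomial (1 / lam) oo (fps_binomial lam - 1)"
    by (simp add: degen_exp_eq_binomial[OF assms] degen_log_nth_0 flip: fps_compose_assoc)
  also have "\<dots> = 1 + fps_X"
    using assms by (simp add: fps_binomial_compose_binomial fps_binomial_1)
  finally show ?thesis .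
qed

theorem theorem6:
  fixes lam x :: real and n :: nat
  assumes "lam \<noteq> 0"
  shows "degen_falling lam x n = (\<Sum>k=0..n. degen_stirling1 lam n k * degen_bell lam k x)"
proof -
  let ?E = "degen_exp lam 1 - 1" and ?B = "Abs_fps (\<lambda>k. degen_bell lam k x / fact k)"
  have "?B oo degen_log lam = degen_exp lam x oo ?E oo degen_log lam"
    by (simp only: degen_bell_gf)
  also have "\<dots> = degen_exp lam x oo (?E oo degen_log lam)"
    by (rule fps_compose_assoc[OF degen_log_nth_0 degen_exp_minus_one_nth_0, symmetric])
  also have "?E oo degen_log lam = fps_X"
    by (simp add: fps_compose_sub_distrib degen_exp_compose_degen_log[OF assms])
  finally have E: "?B oo degen_log lam = degen_exp lam x"
    by simp
  have "degen_falling lam x n = fact n * fps_nth (?B oo degen_log lam) n"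
    unfolding E by (simp add: degen_exp_def)
  also have "\<dots> = (\<Sum>k=0..n. degen_stirling1 lam n k * degen_bell lam k x)"
    \<comment> \<open>The \<open>1 / fact k\<close> in the coefficients of \<open>?B\<close> is the
      one that normalises \<open>degen_log lam ^ k\<close> in \<open>degen_stirling1\<close>; powers
      with \<open>k > n\<close> do not reach the coefficient of \<open>t^n\<close>.\<close>
    by (simp add: fps_compose_nth degen_stirling1_def sum_distrib_left mult_ac)
  finally show ?thesis .
qed

end
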